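(* Let $X=\{0,1\}$ and let $(\mathcal{A},q_0)$ be the initial partial automaton over $X$ with states $Q=\{A,B,C,D\}$, initial state $q_0=A$, transition function $\varphi(A,0)=D$, $\varphi(A,1)=B$, $\varphi(B,1)=C$, $\varphi(C,0)=C$, $\varphi(C,1)=C$, $\varphi(D,0)=A$, with $\varphi(B,0)$ and $\varphi(D,1)$ undefined, and output function $\psi(A,0)=1$, $\psi(A,1)=0$, $\psi(B,1)=0$, $\psi(C,0)=0$, $\psi(C,1)=1$, $\psi(D,0)=1$, with $\psi(B,0)$ and $\psi(D,1)$ undefined. Then the partial automatic permutation $f_{\mathcal{A},q_0}$ is not a group-bound element of the semigroup $\mathcal{ISA}(\{0,1\})$.
   Context: An initial (partial Mealy) automaton $(\mathcal{A},q_0)$ over a finite alphabet $X$ consists of a set $Q$ of internal states, a partial transition function $\varphi:Q\times X\to Q$, a partial output function $\psi:Q\times X\to X$ and an initial state $q_0\in Q$. Extend $\varphi$ to words by $\varphi(q,e)=q$ ($e$ the empty word), $\varphi(q,wx)=\varphi(\varphi(q,w),x)$. The automaton defines the partial transformation $f_{\mathcal{A},q_0}$ of the set $X^*$ of all words over $X$ sending $u=x_1x_2x_3\dots$ to $\psi(q_0,x_1)\psi(\varphi(q_0,x_1),x_2)\psi(\varphi(q_0,x_1x_2),x_3)\dots$, undefined iff at least one of the values of $\varphi$ or $\psi$ in this expression is undefined. A partial automatic permutation is an injective partial transformation of $X^*$ defined in this way; these form an inverse semigroup $\mathcal{ISA}(X)$ under composition of partial maps. An element $a$ of a semigroup $S$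 is group-bound if some power $a^t$, $t\ge1$, belongs to a subgroup of $S$. *)

theory Defs
  imports "HOL-Algebra.Group" "HOL-Library.Z2" "HOL-Library.Countable"
begin

section \<open>Partial automata and the transformations they define\<close>

record ('q, 'x) partial_automaton =
  next_state :: "'q \<Rightarrow> 'x \<rightharpoonup> 'q"
  out_letter :: "'q \<Rightarrow> 'x \<rightharpoonup> 'x"

definition next_word :: "('q, 'x) partial_automaton \<Rightarrow> 'q \<Rightarrow> 'x list \<rightharpoonup> 'q" where
  "next_word M q w = foldl (\<lambda>s x. Option.bind s (\<lambda>p. next_state M p x)) (Some q) w"

lemma next_word_Nil [simp]: "next_word M q [] = Some q"
  by (simp add: next_word_def)

lemma next_word_snoc [simp]:
  "next_word M q (w @ [x]) = Option.bind (next_word M q w) (\<lambda>p. next_state M p x)"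
  by (simp add: next_word_def)

text \<open>
  The \<open>i\<close>-th output letter needs the state reached after the first \<open>i\<close> input letters only, so the
  transition on the last letter of \<open>u\<close> plays no role.  The function \<^const>\<open>those\<close> yields
  \<^const>\<open>None\<close> as soon as one of the letters is undefined.
\<close>

definition automaton_map :: "('q, 'x) partial_automaton \<Rightarrow> 'q \<Rightarrow> 'x list \<rightharpoonup> 'x list" where
  "automaton_map M q u =
     those (map (\<lambda>i. Option.bind (next_word M q (take i u)) (\<lambda>p. out_letter M p (u ! i)))
       [0..<length u])"


section \<open>The semigroup of partial automatic permutations\<close>

text \<open>
  The state set of an automaton is arbitrary.  As only the states reachable from the initial state
  matter, and these are indexed by words over a finite alphabet, states of type \<^typ>\<open>nat\<close> suffice;
  see \<open>automaton_map_in_ISA\<close> below.  The set contains the identity transformation, hence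
  the semigroup is presented as a \<^const>\<open>monoid\<close>.
\<close>

definition ISA :: "('x::finite list \<rightharpoonup> 'x list) monoid" where
  "ISA = \<lparr>carrier = {f. inj_on f (dom f) \<and>
                      (\<exists>(M :: (nat, 'x) partial_automaton) q. f = automaton_map M q)},
          mult = (\<circ>\<^sub>m),
          one = Some\<rparr>"

text \<open>
  A subgroup of a semigroup is a subset that is a group under the induced multiplication; its
  neutral element is an idempotent \<open>e\<close> that need not be the identity of \<open>S\<close>.
\<close>

definition group_bound :: "('a, 'b) monoid_scheme \<Rightarrow> 'a \<Rightarrow> bool" where
  "group_bound S a \<longleftrightarrow>
     (\<exists>t::nat. t \<ge> 1 \<and>
        (\<exists>H e. H \<subseteq> carrier S \<and> group (S\<lparr>carrier := H, one := e\<rparr>) \<and> a [^]\<^bsub>S\<^esub> t \<in> H))"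


section \<open>Basic properties\<close>

lemma next_word_Cons:
  "next_word M q (x # w) = Option.bind (next_state M q x) (\<lambda>p. next_word M p w)"
proof (induction w rule: rev_induct)
  case Nil
  show ?case
    using next_word_snoc[of M q "[]" x] by (cases "next_state M q x") auto
next
  case (snoc y w)
  then show ?case
    using next_word_snoc[of M q "x # w" y] by (cases "next_state M q x") auto
qed

lemma automaton_map_Nil [simp]: "automaton_map M q [] = Some []"
  by (simp add: automaton_map_def)

lemma those_None: "None \<in> set xs \<Longrightarrow> those xs = None"
  by (induction xs) (auto split: option.splits)

lemma automaton_map_Cons:
  "automaton_map M q (x # u) =
     (case out_letter M q x of None \<Rightarrow> None
      | Some y \<Rightarrow>
          if u = [] then Some [y]
          else (case next_state M q x of None \<Rightarrow> None
                | Some p \<Rightarrow> map_option (Cons y) (automaton_map M p u)))"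
proof -
  have *: "[0..<length (x # u)] = 0 # map Suc [0..<length u]"
    by (simp add: upt_conv_Cons map_Suc_upt del: upt_Suc)
  have "those (map (\<lambda>_. None) [0..<length u]) = None" if "u \<noteq> []"
    using that by (intro those_None) (cases u, auto)
  then show ?thesis
    unfolding automaton_map_def *
    by (auto simp: next_word_Cons comp_def those_None split: option.splits)
qed

lemma automaton_map_length: "automaton_map M q u = Some v \<Longrightarrow> length v = length u"
  by (induction u arbitrary: q v) (auto simp: automaton_map_Cons split: option.splits if_splits)

lemma automaton_map_nat_states:
  fixes M :: "('q, 'x::finite) partial_automaton"
  shows "\<exists>(N :: (nat, 'x) partial_automaton) p. automaton_map M q = automaton_map N p"
proof -
  define N :: "(nat, 'x) partial_automaton" where
    "N = \<lparr>next_state = (\<lambda>n x. map_option (\<lambda>_. to_nat (from_nat n @ [x]))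
                          (next_word M q (from_nat n @ [x]))),
          out_letter = (\<lambda>n x. Option.bind (next_word M q (from_nat n)) (\<lambda>p. out_letter M p x))\<rparr>"
  have "next_word N (to_nat ([] :: 'x list)) w = map_option (\<lambda>_. to_nat w) (next_word M q w)" for w
    by (induction w rule: rev_induct)
       (auto simp: N_def bind_map_option comp_def split: option.splits bind_splits)
  then have "automaton_map M q = automaton_map N (to_nat ([] :: 'x list))"
    by (auto simp: fun_eq_iff automaton_map_def N_def bind_map_option comp_def
        intro!: arg_cong[where f = those] split: bind_splits)
  then show ?thesis
    by blast
qed

lemma automaton_map_in_ISA:
  fixes M :: "('q, 'x::finite) partial_automaton"
  shows "automaton_map M q \<in> carrier ISA \<longleftrightarrow> inj_on (automaton_map M q) (dom (automaton_map M q))"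
  using automaton_map_nat_states[of M q] by (auto simp: ISA_def)

lemma automaton_map_comp:
  "automaton_map N q \<circ>\<^sub>m automaton_map M p =
     automaton_map
       \<lparr>next_state = (\<lambda>(p, q) x. Option.bind (next_state M p x) (\<lambda>p'.
           Option.bind (out_letter M p x) (\<lambda>y.
             Option.bind (next_state N q y) (\<lambda>q'. Some (p', q'))))),
        out_letter = (\<lambda>(p, q) x. Option.bind (out_letter M p x) (out_letter N q))\<rparr>
       (p, q)" (is "_ = automaton_map ?K _")
proof
  fix u
  show "(automaton_map N q \<circ>\<^sub>m automaton_map M p) u = automaton_map ?K (p, q) u"
  proof (induction u arbitrary: p q)
    case Nil
    then show ?case by (simp add: map_comp_def)
  next
    case (Cons x u)
    have *: "automaton_map M p' u = Some v \<Longrightarrow> v = [] \<longleftrightarrow> u = []" for p' v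
      using automaton_map_length[of M p' u v] by auto
    show ?case
      using * by (auto simp: automaton_map_Cons map_comp_def Cons.IH[symmetric] split: option.splits bind_splits)
  qed
qed

lemma monoid_ISA: "monoid (ISA :: ('x::finite list \<rightharpoonup> 'x list) monoid)"
proof (rule monoidI)
  fix f g :: "'x list \<rightharpoonup> 'x list"
  assume "f \<in> carrier ISA" "g \<in> carrier ISA"
  then obtain M N :: "(nat, 'x) partial_automaton" and p q where
    f: "f = automaton_map M p" "inj_on f (dom f)" and g: "g = automaton_map N q" "inj_on g (dom g)"
    by (auto simp: ISA_def)
  have "inj_on (f \<circ>\<^sub>m g) (dom (f \<circ>\<^sub>m g))"
  proof (rule inj_onI)
    fix u v
    assume "u \<in> dom (f \<circ>\<^sub>m g)" "v \<in> dom (f \<circ>\<^sub>m g)" "(f \<circ>\<^sub>m g) u = (f \<circ>\<^sub>m g) v"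
    then obtain u' v' where *: "g u = Some u'" "g v = Some v'" "u' \<in> dom f" "v' \<in> dom f" "f u' = f v'"
      by (auto simp: map_comp_def dom_def split: option.splits)
    then have "g u = g v"
      using f(2) by (auto dest: inj_onD)
    then show "u = v"
      using * g(2) by (auto elim!: inj_onD)
  qed
  then have "f \<circ>\<^sub>m g \<in> carrier ISA"
    unfolding f(1) g(1) automaton_map_comp automaton_map_in_ISA .
  then show "f \<otimes>\<^bsub>ISA\<^esub> g \<in> carrier ISA"
    by (simp add: ISA_def)
next
  let ?I = "\<lparr>next_state = (\<lambda>_ _. Some 0), out_letter = (\<lambda>_. Some)\<rparr> :: (nat, 'x) partial_automaton"
  have "automaton_map ?I 0 u = Some u" for u
    by (induction u) (auto simp: automaton_map_Cons)
  then have "Some = automaton_map ?I 0"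
    by auto
  then show "\<one>\<^bsub>ISA\<^esub> \<in> carrier (ISA :: ('x list \<rightharpoonup> 'x list) monoid)"
    unfolding ISA_def by (auto simp: inj_on_def)
qed (auto simp: ISA_def map_comp_def fun_eq_iff split: option.splits)


section \<open>The automaton over the alphabet \<open>{0, 1}\<close>\<close>

instance bit :: finite
proof
  have "(UNIV :: bit set) = {0, 1}"
    by (auto intro: bit.exhaust)
  then show "finite (UNIV :: bit set)"
    by (metis finite.emptyI finite.insertI)
qed

datatype state = A | B | C | D

fun \<phi> :: "state \<Rightarrow> bit \<rightharpoonup> state" where
  "\<phi> A = [0 \<mapsto> D, 1 \<mapsto> B]"
| "\<phi> B = [1 \<mapsto> C]"
| "\<phi> C = [0 \<mapsto> C, 1 \<mapsto> C]"
| "\<phi> D = [0 \<mapsto> A]"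

fun \<psi> :: "state \<Rightarrow> bit \<rightharpoonup> bit" where
  "\<psi> A = [0 \<mapsto> 1, 1 \<mapsto> 0]"
| "\<psi> B = [1 \<mapsto> 0]"
| "\<psi> C = [0 \<mapsto> 0, 1 \<mapsto> 1]"
| "\<psi> D = [0 \<mapsto> 1]"

definition aut :: "(state, bit) partial_automaton" where
  "aut = \<lparr>next_state = \<phi>, out_letter = \<psi>\<rparr>"

end

theory Submission
  imports Defs
begin

text \<open>
  Write \<open>f\<close> for the transformation and read words in blocks of two letters, \<open>00\<close> and \<open>11\<close> being the
  binary digits \<open>0\<close> and \<open>1\<close>, least significant digit first.  Then \<open>f\<close> sends \<open>(00)\<^sup>k 11 w\<close> to
  \<open>(11)\<^sup>k 00 w\<close>: it subtracts one from the number coded by the blocks.  A block \<open>01\<close> is an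
  end marker that no borrow can cross.  So \<open>(11)\<^sup>m 01\<close> can be decremented exactly \<open>2\<^sup>m - 1\<close> times,
  down to \<open>z = (00)\<^sup>m 01\<close>, where \<open>f\<close> is undefined (\<open>dec_pow_countdown\<close>).

  An element of a subgroup of a semigroup of partial maps has its range contained in its domain
  (\<open>group_element_range_subset_dom\<close>).  Given \<open>t \<ge> 1\<close>, choose \<open>m\<close> with \<open>t < 2\<^sup>m\<close>.  The last \<open>t\<close> steps
  of the countdown put \<open>z\<close> in the range of \<open>f\<^sup>t\<close>, while \<open>z\<close> is not in its domain.  Hence no
  positive power of \<open>f\<close> lies in a subgroup.
\<close>

text \<open>
  The output letters are read off in order; injectivity of the output function recovers the current
  input letter, hence the next state, and so on.
\<close>

lemma automaton_map_inject:
  assumes inj: "\<And>q. inj_on (out_letter M q) (dom (out_letter M q))"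
  assumes "automaton_map M q u = Some w" "automaton_map M q v = Some w"
  shows "u = v"
  using assms(2,3)
proof (induction u arbitrary: q v w)
  case Nil
  then show ?case
    using automaton_map_length[of M q v w] by simp
next
  case (Cons x u)
  have "length v = length (x # u)"
    using Cons.prems[THEN automaton_map_length] by simp
  then obtain x' v' where v: "v = x' # v'" and len: "length v' = length u"
    by (cases v) auto
  have "\<exists>y. out_letter M q x = Some y \<and> out_letter M q x' = Some y"
    using Cons.prems len unfolding v
    by (auto simp: automaton_map_Cons split: option.splits if_splits)
  then have "x = x'"
    by (metis inj_onD[OF inj] domI)
  moreover have "u = v'"
    using Cons.prems Cons.IH len unfolding v \<open>x = x'\<close>
    by (auto simp: automaton_map_Cons split: option.splits if_splits)
  ultimately show ?case
    by (simp add: v)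
qed

lemma inj_on_automaton_map_aut: "inj_on (automaton_map aut q) (dom (automaton_map aut q))"
proof -
  have "inj_on (out_letter aut p) (dom (out_letter aut p))" for p
    by (cases p) (auto simp: aut_def inj_on_def split: if_splits)
  then show ?thesis
    by (metis automaton_map_inject domD inj_onI)
qed

text \<open>
  With \<open>e\<close> the neutral element and \<open>b\<close> the inverse of \<open>g\<close>, the equation \<open>e g = g\<close> makes \<open>e\<close> fix
  every value \<open>y\<close> of \<open>g\<close>, so that \<open>b g = e\<close> is defined at \<open>y\<close>.
\<close>

lemma group_element_range_subset_dom:
  assumes "group (ISA\<lparr>carrier := H, one := e\<rparr>)" and "g \<in> H"
  shows "ran g \<subseteq> dom g"
proof
  fix y
  assume "y \<in> ran g"
  then obtain x where x: "g x = Some y"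
    by (auto simp: ran_def)
  interpret group "ISA\<lparr>carrier := H, one := e\<rparr>"
    by fact
  have "e \<circ>\<^sub>m g = g"
    using l_one[of g] \<open>g \<in> H\<close> by (simp add: ISA_def)
  then have "e y = Some y"
    using x by (metis map_comp_simps(2))
  moreover obtain b where "b \<circ>\<^sub>m g = e"
    using l_inv_ex[of g] \<open>g \<in> H\<close> by (auto simp: ISA_def)
  ultimately show "y \<in> dom g"
    by (metis domI map_comp_Some_iff)
qed

lemma automaton_map_aut_C: "automaton_map aut C u = Some u"
  by (induction u) (auto simp: automaton_map_Cons aut_def bit_not_zero_iff)

lemma automaton_map_aut_A:
  "automaton_map aut A (1 # 1 # w) = Some (0 # 0 # w)"
  "automaton_map aut A (0 # 0 # w) =
     map_option (\<lambda>v. 1 # 1 # v) (automaton_map aut A w)"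
  "automaton_map aut A (0 # 1 # w) = None"
  using automaton_map_aut_C[of w]
  by (auto simp: automaton_map_Cons aut_def option.map_comp comp_def)

definition dec_pow :: "nat \<Rightarrow> bit list \<rightharpoonup> bit list" where
  "dec_pow n = automaton_map aut A [^]\<^bsub>ISA\<^esub> n"

lemma aut_in_ISA: "automaton_map aut A \<in> carrier ISA"
  by (simp add: automaton_map_in_ISA inj_on_automaton_map_aut)

lemma dec_pow_0: "dec_pow 0 = Some"
  by (simp add: dec_pow_def ISA_def)

lemma dec_pow_Suc: "dec_pow (Suc n) = dec_pow n \<circ>\<^sub>m automaton_map aut A"
  by (simp add: dec_pow_def ISA_def)

lemma dec_pow_add: "dec_pow (m + n) = dec_pow m \<circ>\<^sub>m dec_pow n"
  using monoid.nat_pow_mult[OF monoid_ISA aut_in_ISA, of m n]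
  by (simp add: dec_pow_def ISA_def)

text \<open>
  The lowest digit returns to \<open>1\<close> after two decrements, the second of which borrows from the
  remaining digits.
\<close>

lemma dec_pow_double:
  "dec_pow (2 * n) (1 # 1 # w) = map_option (\<lambda>v. 1 # 1 # v) (dec_pow n w)"
proof (induction n arbitrary: w)
  case 0
  then show ?case
    by (simp add: dec_pow_0)
next
  case (Suc n)
  have "dec_pow (2 * Suc n) (1 # 1 # w) = (dec_pow (2 * n) \<circ>\<^sub>m automaton_map aut A) (0 # 0 # w)"
    by (simp add: dec_pow_Suc map_comp_def automaton_map_aut_A)
  also have "\<dots> = map_option (\<lambda>v. 1 # 1 # v) (dec_pow (Suc n) w)"
    by (simp add: dec_pow_Suc map_comp_def automaton_map_aut_A Suc.IH split: option.splits)
  finally show ?case .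
qed

lemma dec_pow_countdown:
  "dec_pow (2 ^ m - 1) (replicate (2 * m) 1 @ w) = Some (replicate (2 * m) 0 @ w)"
proof (induction m)
  case 0
  then show ?case
    by (simp add: dec_pow_0)
next
  case (Suc m)
  \<comment> \<open>Count the upper digits down to zero, then clear the lowest digit.\<close>
  have "2 ^ Suc m - 1 = Suc 0 + 2 * (2 ^ m - 1 :: nat)"
    using one_le_power[of "2 :: nat" m] unfolding power_Suc by linarith
  then have "dec_pow (2 ^ Suc m - 1) = dec_pow (Suc 0) \<circ>\<^sub>m dec_pow (2 * (2 ^ m - 1))"
    by (simp only: dec_pow_add)
  then show ?case
    by (simp add: dec_pow_double dec_pow_0 dec_pow_Suc Suc.IH automaton_map_aut_A map_comp_def
        del: One_nat_def)
qed

lemma automaton_map_aut_zeros_marker: "automaton_map aut A (replicate (2 * m) 0 @ [0, 1]) = None"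
  by (induction m) (simp_all add: automaton_map_aut_A)

theorem lemma12:
  shows "automaton_map aut A \<in> carrier ISA \<and> \<not> group_bound ISA (automaton_map aut A)"
proof
  show "automaton_map aut A \<in> carrier ISA"
    by (rule aut_in_ISA)
  show "\<not> group_bound ISA (automaton_map aut A)"
  proof
    assume "group_bound ISA (automaton_map aut A)"
    then obtain t H e where "t \<ge> 1" and "group (ISA\<lparr>carrier := H, one := e\<rparr>)" "dec_pow t \<in> H"
      by (auto simp: group_bound_def dec_pow_def)
    then have sub: "ran (dec_pow t) \<subseteq> dom (dec_pow t)"
      by (intro group_element_range_subset_dom)
    define z :: "bit list" where "z = replicate (2 * t) 0 @ [0, 1]"
    \<comment> \<open>As \<open>t < 2\<^sup>t\<close>, here \<open>t\<close> digits suffice for a countdown of at least \<open>t\<close> steps.\<close>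
    have "2 ^ t - 1 = t + (2 ^ t - 1 - t)"
      using less_exp[of t] by linarith
    then have "dec_pow (2 ^ t - 1) = dec_pow t \<circ>\<^sub>m dec_pow (2 ^ t - 1 - t)"
      by (metis dec_pow_add)
    then have "z \<in> ran (dec_pow t)"
      using dec_pow_countdown[of t "[0, 1]"]
      by (auto simp: z_def ran_def map_comp_Some_iff)
    with sub have "z \<in> dom (dec_pow t)"
      by blast
    moreover obtain n where "t = Suc n"
      using \<open>t \<ge> 1\<close> by (cases t) auto
    ultimately show False
      using automaton_map_aut_zeros_marker[of t]
      by (auto simp: z_def dec_pow_Suc map_comp_Some_iff)
  qed
qed

end
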